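(* Let $X$ be a partially ordered set, $\Lambda$ a totally ordered set, $u:X\to\Lambda$ a quasi-Leontief function and $S\subset X$ a comprehensive subset. Then $\arg\max(u;S)$ is not empty if and only if $S\cap\mathcal{E}(u;X)$ contains a largest element. Furthermore, if $\bar x$ is the largest element of $S\cap\mathcal{E}(u;X)$ then $\bar x\in\arg\max(u;S)$ and, for all $x\in\arg\max(u;S)$, $x\geqslant\bar x$.
   Context: $u:X\to\Lambda$ is quasi-Leontief if for every $x\in X$ there is $x^\circ\in X$ with $\{x'\in X:u(x')\geqslant u(x)\}=\{x'\in X:x'\geqslant x^\circ\}$. A point $x\in X$ is efficient with respect to $u$ if for all $x'\in X$, $u(x')\geqslant u(x)$ implies $x'\geqslant x$; $\mathcal{E}(u;X)$ is the set of efficient points. $S$ is comprehensive if $x'\in S$ and $x\leqslant x'$ imply $x\in S$. $\arg\max(u;S)=\{x\in S:u(x)\geqslant u(x')\text{ for all }x'\in S\}$. *)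

theory Defs
  imports Main
begin

text \<open>
  A partially ordered set is a set \<open>X\<close> of elements of an ordered type, with the induced order;
  this includes the empty poset. All notions are relative to \<open>X\<close>: values of \<open>u\<close> outside \<open>X\<close> are
  never inspected.
\<close>

definition quasi_Leontief :: "'a::order set \<Rightarrow> ('a \<Rightarrow> 'b::linorder) \<Rightarrow> bool" where
  "quasi_Leontief X u \<longleftrightarrow>
     (\<forall>x\<in>X. \<exists>x0\<in>X. {x' \<in> X. u x' \<ge> u x} = {x' \<in> X. x' \<ge> x0})"

definition efficient_points :: "('a::order \<Rightarrow> 'b::linorder) \<Rightarrow> 'a set \<Rightarrow> 'a set" where
  "efficient_points u X = {x \<in> X. \<forall>x'\<in>X. u x' \<ge> u x \<longrightarrow> x' \<ge> x}"

definition comprehensive :: "'a::order set \<Rightarrow> 'a set \<Rightarrow> bool" where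
  "comprehensive X S \<longleftrightarrow> (\<forall>x'\<in>S. \<forall>x\<in>X. x \<le> x' \<longrightarrow> x \<in> S)"

definition argmax_set :: "('a \<Rightarrow> 'b::linorder) \<Rightarrow> 'a set \<Rightarrow> 'a set" where
  "argmax_set u S = {x \<in> S. \<forall>x'\<in>S. u x \<ge> u x'}"

definition is_largest :: "'a::order set \<Rightarrow> 'a \<Rightarrow> bool" where
  "is_largest A m \<longleftrightarrow> m \<in> A \<and> (\<forall>a\<in>A. a \<le> m)"

end

theory Submission
  imports Defs
begin

text \<open>Each upper level set of \<open>u\<close> is generated by a single point, and
  \<open>quasi_Leontief_efficient_below\<close> shows that this generator is efficient. The
  generator \<open>y\<close> for \<open>x\<close> lies below \<open>x\<close>, so comprehensiveness
  keeps it in \<open>S\<close> whenever \<open>x\<close> is in \<open>S\<close>. Thus efficient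
  points of \<open>S\<close> test membership in level sets: a largest one dominates all generators
  coming from \<open>S\<close>, hence lies in all their level sets and maximizes \<open>u\<close>.
  Conversely, the generator for a maximizer is the largest efficient point of
  \<open>S\<close>.\<close>

lemma quasi_Leontief_efficient_below:
  assumes "quasi_Leontief X u" and "x \<in> X"
  obtains y where "y \<in> efficient_points u X" and "y \<le> x"
    and "\<And>x'. x' \<in> X \<Longrightarrow> u x \<le> u x' \<longleftrightarrow> y \<le> x'"
proof -
  obtain y where y: "y \<in> X" and eq: "{x' \<in> X. u x' \<ge> u x} = {x' \<in> X. x' \<ge> y}"
    using assms unfolding quasi_Leontief_def by blast
  have iff: "u x \<le> u x' \<longleftrightarrow> y \<le> x'" if "x' \<in> X" for x'
    using eq that by blast
  have "u x \<le> u y"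
    using iff[OF y] by simp
  \<comment> \<open>Since \<open>u x \<le> u y\<close>, any point at least as good as
    \<open>y\<close> is at least as good as \<open>x\<close>, hence lies above
    \<open>y\<close>.\<close>
  then have "y \<in> efficient_points u X"
    using y iff order_trans[of "u x" "u y"] unfolding efficient_points_def by blast
  moreover have "y \<le> x"
    using iff[OF assms(2)] by simp
  ultimately show thesis
    using iff that by blast
qed

theorem proposition2p4p1:
  fixes X S :: "'a::order set" and u :: "'a \<Rightarrow> 'b::linorder"
  assumes "quasi_Leontief X u"
    and "S \<subseteq> X"
    and "comprehensive X S"
  shows "(argmax_set u S \<noteq> {} \<longleftrightarrow> (\<exists>m. is_largest (S \<inter> efficient_points u X) m)) \<and>
    (\<forall>xbar. is_largest (S \<inter> efficient_points u X) xbar \<longrightarrow>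
       xbar \<in> argmax_set u S \<and> (\<forall>x \<in> argmax_set u S. x \<ge> xbar))"
proof -
  let ?E = "efficient_points u X"
  have E_subset: "?E \<subseteq> X"
    unfolding efficient_points_def by blast
  have efficientD: "e \<le> x" if "e \<in> ?E" "x \<in> X" "u e \<le> u x" for e x
    using that unfolding efficient_points_def by blast
  have below: "\<exists>y \<in> S \<inter> ?E. \<forall>x' \<in> X. u x \<le> u x' \<longleftrightarrow> y \<le> x'" if "x \<in> S" for x
  proof -
    from that assms(2) have "x \<in> X" ..
    from quasi_Leontief_efficient_below[OF assms(1) this] obtain y where
      y: "y \<in> ?E" "y \<le> x" "\<And>x'. x' \<in> X \<Longrightarrow> u x \<le> u x' \<longleftrightarrow> y \<le> x'" by blast
    have "y \<in> S"
      using assms(3) that y E_subset unfolding comprehensive_def by blast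
    with y show ?thesis by blast
  qed
  have largest: "m \<in> argmax_set u S \<and> (\<forall>x \<in> argmax_set u S. m \<le> x)"
    if m: "is_largest (S \<inter> ?E) m" for m
  proof -
    have mSE: "m \<in> S" "m \<in> ?E" and max: "\<And>a. a \<in> S \<inter> ?E \<Longrightarrow> a \<le> m"
      using m unfolding is_largest_def by auto
    \<comment> \<open>The generator for \<open>x\<close> is an efficient point of \<open>S\<close>,
      so it is below \<open>m\<close>; the equivalence from \<open>below\<close>, read at
      \<open>m\<close>, turns this into \<open>u x \<le> u m\<close>.\<close>
    have "u x \<le> u m" if "x \<in> S" for x
      using below[OF that] max mSE assms(2) by blast
    then have "m \<in> argmax_set u S"
      using mSE unfolding argmax_set_def by blast
    \<comment> \<open>A maximizer satisfies \<open>u m \<le> u x\<close>, so efficiency of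
      \<open>m\<close> applies.\<close>
    moreover have "m \<le> x" if "x \<in> argmax_set u S" for x
      using that efficientD mSE assms(2) unfolding argmax_set_def by blast
    ultimately show ?thesis by blast
  qed
  have "\<exists>m. is_largest (S \<inter> ?E) m" if x: "x \<in> argmax_set u S" for x
  proof -
    have xS: "x \<in> S" and max: "\<And>a. a \<in> S \<Longrightarrow> u a \<le> u x"
      using x unfolding argmax_set_def by auto
    from below[OF xS] obtain y where
      y: "y \<in> S" "y \<in> ?E" and iff: "\<And>x'. x' \<in> X \<Longrightarrow> u x \<le> u x' \<longleftrightarrow> y \<le> x'" by blast
    have yX: "y \<in> X"
      using y assms(2) by blast
    then have "u x \<le> u y"
      using iff by simp
    \<comment> \<open>Maximality of \<open>x\<close> gives \<open>u a \<le> u x \<le> u y\<close>,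
      and efficiency of \<open>a\<close> converts this comparison of values into one of
      points.\<close>
    then have "a \<le> y" if "a \<in> S \<inter> ?E" for a
      using that max[of a] efficientD[of a y] yX by (auto intro: order_trans)
    with y show ?thesis
      unfolding is_largest_def by blast
  qed
  with largest show ?thesis by blast
qed

end
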